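(* Let $X$ be a finite set with at least $6$ elements, let $p\ge 3$, let $G$ be a primitive group acting on $X$, and let $f:X\to X$ be a map of kernel type $(p,2,1,\dots,1)$, that is, $f$ has one kernel class of size $p$, one kernel class of size $2$, and an arbitrary number of singleton kernel classes. Then $G$ synchronizes $f$.
   Context: A permutation group $G$ on $X$ is primitive if it is transitive and preserves no equivalence relation on $X$ other than equality and the universal relation. The kernel classes of $f$ are its non-empty fibres. $G$ synchronizes $f$ if the transformation semigroup $\langle G,f\rangle$ contains a constant map. *)

theory Defs
  imports "HOL-Algebra.Group_Action" "HOL-Library.Multiset"
begin

text \<open>Maps from \<open>X\<close> to \<open>X\<close> are the elements of \<open>X \<rightarrow>\<^sub>E X\<close>, in accordance with \<open>BijGroup\<close>,
  whose elements are extensional bijections multiplied by \<open>compose X\<close>. A permutation group on \<open>X\<close>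
  is a subgroup of \<open>BijGroup X\<close>, given by its carrier.\<close>

definition primitive_perm_group :: "'a set \<Rightarrow> ('a \<Rightarrow> 'a) set \<Rightarrow> bool" where
  "primitive_perm_group X G \<longleftrightarrow>
     subgroup G (BijGroup X) \<and>
     transitive_action (BijGroup X\<lparr>carrier := G\<rparr>) X (\<lambda>g. g) \<and>
     (\<forall>r. equiv X r \<and> (\<forall>g\<in>G. \<forall>(x, y)\<in>r. (g x, g y) \<in> r) \<longrightarrow> r = Id_on X \<or> r = X \<times> X)"

definition kernel_classes :: "'a set \<Rightarrow> ('a \<Rightarrow> 'b) \<Rightarrow> 'a set set" where
  "kernel_classes X f = (\<lambda>y. {x \<in> X. f x = y}) ` (f ` X)"

definition kernel_type :: "'a set \<Rightarrow> ('a \<Rightarrow> 'b) \<Rightarrow> nat multiset" where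
  "kernel_type X f = image_mset card (mset_set (kernel_classes X f))"

inductive_set generated_semigroup :: "'a set \<Rightarrow> ('a \<Rightarrow> 'a) set \<Rightarrow> ('a \<Rightarrow> 'a) set"
  for X :: "'a set" and S :: "('a \<Rightarrow> 'a) set" where
  generator: "s \<in> S \<Longrightarrow> s \<in> generated_semigroup X S"
| product: "s \<in> generated_semigroup X S \<Longrightarrow> t \<in> generated_semigroup X S \<Longrightarrow>
    compose X s t \<in> generated_semigroup X S"

definition synchronizes :: "'a set \<Rightarrow> ('a \<Rightarrow> 'a) set \<Rightarrow> ('a \<Rightarrow> 'a) \<Rightarrow> bool" where
  "synchronizes X G f \<longleftrightarrow>
     (\<exists>h \<in> generated_semigroup X (insert f G). \<exists>c\<in>X. \<forall>x\<in>X. h x = c)"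

end

theory Submission
  imports Defs
begin

text \<open>
  Suppose that \<open>G\<close> does not synchronize \<open>f\<close>, and join two points of \<open>X\<close> by an edge if no member of
  the semigroup \<open>\<langle>G, f\<rangle>\<close> maps them to the same point. Every member of the semigroup preserves edges,
  so \<open>G\<close> acts primitively on this graph, which is therefore regular of some degree \<open>d\<close>, and \<open>f\<close> is an
  endomorphism. The graph is not complete, because \<open>f\<close> is not injective. It has an edge, because
  otherwise images could be shrunk until a constant map is reached. By primitivity, distinct vertices
  have distinct neighbourhoods.

  Let \<open>A\<close> be the kernel class of size \<open>p\<close> and \<open>M\<close> the union of the neighbourhoods of its points. Since
  \<open>A\<close> is independent, \<open>M\<close> is disjoint from \<open>A\<close>, so \<open>f\<close> becomes injective on \<open>M\<close> once one point of the
  kernel class of size 2 is removed. As \<open>f\<close> maps \<open>M\<close> into a single neighbourhood, \<open>M\<close> has at most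
  \<open>d + 1\<close> elements. Thus there are at least three vertices whose neighbourhoods lie in one set of
  size \<open>d + 1\<close>.

  This is impossible in a primitive graph that is neither empty nor complete. Call a set of \<open>d + 1\<close>
  vertices a line through every vertex whose neighbourhood it contains, provided that there are at
  least three of these. A line through \<open>x\<close> is \<open>N(x)\<close> with one point added. The
  decisive observation is a reciprocity (lemma \<open>reciprocity\<close>): if \<open>N(x) \<union> {m}\<close> and \<open>N(m) \<union> {w}\<close> are
  lines, then \<open>w = x\<close>. Hence some point, and by transitivity every point, is on exactly one line. Being
  on a common line is then an invariant equivalence relation other than equality, so one line passes
  through all vertices, and this forces the graph to be complete.
\<close>

section \<open>Graphs with a primitive group of automorphisms\<close>

lemma two_elements:
  assumes "2 \<le> card S"
  obtains u v where "u \<in> S" "v \<in> S" "u \<noteq> v"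
proof -
  have "finite S" using assms by (intro card_ge_0_finite) simp
  then show ?thesis using assms that card_le_Suc0_iff_eq[of S] by fastforce
qed

lemma perm_group_maps:
  assumes "primitive_perm_group X G"
  shows "G \<subseteq> X \<rightarrow> X" and "g \<in> G \<Longrightarrow> bij_betw g X X"
proof -
  have "G \<subseteq> carrier (BijGroup X)"
    using assms subgroup.subset unfolding primitive_perm_group_def by blast
  then have *: "G \<subseteq> Bij X" by (simp add: BijGroup_def)
  then show "G \<subseteq> X \<rightarrow> X" using Bij_imp_funcset by blast
  show "bij_betw g X X" if "g \<in> G" using * that by (auto simp: Bij_def)
qed

locale primitive_graph =
  fixes X :: "'a set" and G :: "('a \<Rightarrow> 'a) set" and adj :: "'a \<Rightarrow> 'a \<Rightarrow> bool"
  assumes finite_vertices: "finite X"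
    and primitive: "primitive_perm_group X G"
    and adj_in: "adj x y \<Longrightarrow> x \<in> X \<and> y \<in> X"
    and adj_sym: "adj x y \<Longrightarrow> adj y x"
    and adj_irrefl: "\<not> adj x x"
    and adj_image: "g \<in> G \<Longrightarrow> adj x y \<Longrightarrow> adj (g x) (g y)"
    and not_empty: "\<exists>x y. adj x y"
    and not_complete: "\<exists>x\<in>X. \<exists>y\<in>X. x \<noteq> y \<and> \<not> adj x y"
begin

definition nbhd :: "'a \<Rightarrow> 'a set" where
  "nbhd x = {y. adj x y}"

definition degree :: nat where
  "degree = card (nbhd (SOME x. x \<in> X))"

text \<open>If \<open>M\<close> is a line, these are the vertices that it passes through. They need not belong to \<open>M\<close>.\<close>

definition inside :: "'a set \<Rightarrow> 'a set" where
  "inside M = {x \<in> X. nbhd x \<subseteq> M}"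

definition lines :: "'a set set" where
  "lines = {M. M \<subseteq> X \<and> card M = Suc degree \<and> 3 \<le> card (inside M)}"

lemma group_bij: "g \<in> G \<Longrightarrow> bij_betw g X X"
  using perm_group_maps(2)[OF primitive] .

lemma transitive: "\<exists>g\<in>G. g x = y" if "x \<in> X" "y \<in> X"
  using primitive that transitive_action.unique_orbit[of "BijGroup X\<lparr>carrier := G\<rparr>" X "\<lambda>g. g" x y]
  by (simp add: primitive_perm_group_def)

lemma no_invariant_equiv:
  assumes "equiv X r" and "\<And>g x y. g \<in> G \<Longrightarrow> (x, y) \<in> r \<Longrightarrow> (g x, g y) \<in> r"
  shows "r = Id_on X \<or> r = X \<times> X"
  using primitive assms unfolding primitive_perm_group_def by blast

lemma nbhd_subset: "nbhd x \<subseteq> X"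
  using adj_in by (auto simp: nbhd_def)

lemma finite_nbhd: "finite (nbhd x)"
  using nbhd_subset finite_vertices finite_subset by blast

lemma card_image_group: "card (g ` S) = card S" if "g \<in> G" "S \<subseteq> X"
  using group_bij[OF that(1)] that(2) by (meson bij_betw_def card_image inj_on_subset)

lemma image_nbhd_subset: "g ` nbhd x \<subseteq> nbhd (g x)" if "g \<in> G"
  using adj_image[OF that] by (auto simp: nbhd_def)

lemma card_nbhd: "card (nbhd x) = degree" if "x \<in> X"
proof -
  have le: "card (nbhd u) \<le> card (nbhd v)" if uv: "u \<in> X" "v \<in> X" for u v
  proof -
    obtain g where g: "g \<in> G" "g u = v" using transitive[OF uv] by blast
    then show ?thesis
      using card_mono[OF finite_nbhd image_nbhd_subset[OF g(1)]]
        card_image_group[OF g(1) nbhd_subset] by metis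
  qed
  have "(SOME x. x \<in> X) \<in> X" using that by (rule someI)
  then show ?thesis unfolding degree_def using le that by (meson le_antisym)
qed

text \<open>All degrees agree, so the image of a neighbourhood fills the one that contains it.\<close>

lemma nbhd_image: "nbhd (g x) = g ` nbhd x" if "g \<in> G" "x \<in> X"
proof -
  have "g x \<in> X" using group_bij[OF that(1)] that(2) by (rule bij_betwE[rule_format])
  then show ?thesis
    using card_subset_eq[OF finite_nbhd image_nbhd_subset[OF that(1)]]
      card_image_group[OF that(1) nbhd_subset] card_nbhd that(2) by metis
qed

text \<open>Having equal neighbourhoods is an invariant equivalence relation. It is not universal, because
  the ends of an edge are not related.\<close>

lemma inj_nbhd: "x = y" if "x \<in> X" "y \<in> X" "nbhd x = nbhd y"
proof -
  define r where "r = {(x, y). x \<in> X \<and> y \<in> X \<and> nbhd x = nbhd y}"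
  have "equiv X r"
    by (auto simp: r_def equiv_def refl_on_def sym_def trans_def)
  moreover have "(g x, g y) \<in> r" if "g \<in> G" "(x, y) \<in> r" for g x y
    using that nbhd_image bij_betwE[OF group_bij[OF that(1)]] by (auto simp: r_def)
  ultimately have "r = Id_on X \<or> r = X \<times> X" by (rule no_invariant_equiv)
  moreover have "r \<noteq> X \<times> X"
  proof
    assume "r = X \<times> X"
    moreover obtain u v where uv: "adj u v" using not_empty by blast
    ultimately have "nbhd u = nbhd v" using adj_in by (auto simp: r_def)
    then show False using uv adj_irrefl by (auto simp: nbhd_def)
  qed
  ultimately show ?thesis using that by (auto simp: r_def)
qed

lemma finite_inside: "finite (inside M)"
  using finite_vertices by (simp add: inside_def)

lemma line_missing_point:
  assumes "M \<in> lines" "x \<in> inside M"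
  obtains m where "m \<in> X" "m \<notin> nbhd x" "M = insert m (nbhd x)"
proof -
  have M: "M \<subseteq> X" "card M = Suc degree" "nbhd x \<subseteq> M" "x \<in> X"
    using assms by (auto simp: lines_def inside_def)
  then have "card (M - nbhd x) = 1"
    using card_nbhd[of x] by (simp add: card_Diff_subset finite_nbhd)
  then obtain m where "M - nbhd x = {m}" using card_1_singletonE by blast
  with M show ?thesis by (intro that[of m]) auto
qed

text \<open>Distinct vertices on a line omit distinct points of it, since the omitted point determines the
  neighbourhood.\<close>

lemma missing_point_unique:
  assumes "M \<in> lines" "x \<in> inside M" "y \<in> inside M" "m \<in> M" "m \<notin> nbhd x" "m \<notin> nbhd y"
  shows "x = y"
proof -
  have eq: "nbhd z = M - {m}" if z: "z \<in> inside M" "m \<notin> nbhd z" for z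
  proof -
    obtain m' where "m' \<notin> nbhd z" "M = insert m' (nbhd z)"
      using line_missing_point assms(1) z(1) by metis
    with z(2) assms(4) show ?thesis by auto
  qed
  have "nbhd x = nbhd y" using eq[OF assms(2,5)] eq[OF assms(3,6)] by simp
  then show ?thesis using inj_nbhd assms by (auto simp: inside_def)
qed

text \<open>The entry of the adjacency matrix at \<open>y\<close> on \<open>M\<close> and \<open>u\<close> on \<open>M'\<close> can be read off either line.
  If \<open>w \<noteq> x\<close>, then comparing the two readings shows that \<open>y\<close> is the point of \<open>M'\<close> omitted by every
  \<open>u \<noteq> m\<close> on \<open>M'\<close>. But there are two such \<open>u\<close>, and they omit distinct points.\<close>

lemma reciprocity:
  assumes M: "M \<in> lines" "x \<in> inside M" "M = insert m (nbhd x)" "m \<notin> nbhd x"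
    and M': "M' \<in> lines" "m \<in> inside M'" "M' = insert w (nbhd m)" "w \<notin> nbhd m"
  shows "w = x"
proof (rule ccontr)
  assume "w \<noteq> x"
  moreover have "x \<notin> nbhd m" using M(4) adj_sym by (auto simp: nbhd_def)
  ultimately have "x \<notin> M'" using M'(3) by auto
  have "2 \<le> card (inside M)" using M(1) by (simp add: lines_def)
  then obtain y where y: "y \<in> inside M" "y \<noteq> x" by (metis two_elements)
  have "m \<in> nbhd y" using missing_point_unique[of M x y m] M y by blast
  then have "y \<in> M'" using M'(3) adj_sym by (auto simp: nbhd_def)
  have not_adj: "y \<notin> nbhd u" if u: "u \<in> inside M'" "u \<noteq> m" for u
  proof -
    have "x \<notin> nbhd u" using u(1) \<open>x \<notin> M'\<close> by (auto simp: inside_def)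
    then have "u \<notin> nbhd x" using adj_sym by (auto simp: nbhd_def)
    then have "u \<notin> M" using u(2) M(3) by auto
    then have "u \<notin> nbhd y" using y by (auto simp: inside_def)
    then show ?thesis using adj_sym by (auto simp: nbhd_def)
  qed
  have "card (inside M' - {m}) \<ge> 2"
    using M'(1,2) finite_inside[of M'] by (auto simp: lines_def card_Diff_singleton)
  then obtain u v where "u \<in> inside M' - {m}" "v \<in> inside M' - {m}" "u \<noteq> v"
    by (rule two_elements)
  then show False using missing_point_unique[of M' u v y] M'(1) \<open>y \<in> M'\<close> not_adj by blast
qed

lemma inside_image: "g x \<in> inside (g ` M)" if "g \<in> G" "x \<in> inside M"
proof -
  have "x \<in> X" "nbhd x \<subseteq> M" using that(2) by (auto simp: inside_def)
  then show ?thesis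
    using nbhd_image[OF that(1)] bij_betwE[OF group_bij[OF that(1)]] by (auto simp: inside_def)
qed

lemma line_image: "g ` M \<in> lines" if "g \<in> G" "M \<in> lines"
proof -
  have "inside M \<subseteq> X" by (auto simp: inside_def)
  moreover have "g ` inside M \<subseteq> inside (g ` M)" using inside_image[OF that(1)] by blast
  ultimately have "card (inside M) \<le> card (inside (g ` M))"
    using card_mono[OF finite_inside] card_image_group[OF that(1)] by metis
  then show ?thesis
    using that bij_betwE[OF group_bij[OF that(1)]] card_image_group[OF that(1), of M]
    by (auto simp: lines_def)
qed

text \<open>Reciprocity gives the uniqueness at a point \<open>m\<close> that is omitted by some vertex \<open>x\<close> on a line:
  every line through \<open>m\<close> is \<open>N(m) \<union> {x}\<close>. Transitivity carries it to all vertices.\<close>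

lemma unique_line:
  assumes "lines \<noteq> {}" and "z \<in> X"
  shows "\<exists>!M. M \<in> lines \<and> z \<in> inside M"
proof -
  obtain M where M: "M \<in> lines" using assms(1) by blast
  then obtain x where x: "x \<in> inside M" by (force simp: lines_def)
  obtain m where m: "m \<in> X" "m \<notin> nbhd x" "M = insert m (nbhd x)"
    using line_missing_point[OF M x] .
  have through_m: "M' = insert x (nbhd m)" if "M' \<in> lines" "m \<in> inside M'" for M'
    using line_missing_point[OF that] reciprocity[OF M x m(3,2) that] by metis
  obtain g where g: "g \<in> G" "g x = z"
    using transitive assms(2) x by (auto simp: inside_def)
  obtain h where h: "h \<in> G" "h z = m" using transitive assms(2) m(1) by blast
  have "M1 = M2" if "M1 \<in> lines" "z \<in> inside M1" "M2 \<in> lines" "z \<in> inside M2" for M1 M2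
  proof -
    have "h ` M1 = h ` M2"
      using through_m line_image[OF h(1)] inside_image[OF h(1)] h(2) that by metis
    moreover have "inj_on h X" using group_bij[OF h(1)] by (simp add: bij_betw_def)
    ultimately show ?thesis using that inj_on_image_eq_iff by (fastforce simp: lines_def)
  qed
  then show ?thesis using line_image[OF g(1) M] inside_image[OF g(1) x] g(2) by blast
qed

text \<open>Given a line, uniqueness makes being on a common line an invariant equivalence relation. It is
  not equality, so the line passes through all vertices. Then every vertex of this line is adjacent
  to all the others, and there is no neighbourhood left for a vertex outside it.\<close>

lemma no_lines: "lines = {}"
proof (rule ccontr)
  assume ne: "lines \<noteq> {}"
  then obtain M where M: "M \<in> lines" by blast
  note uniq = unique_line[OF ne]
  define r where "r = {(x, y). \<exists>L\<in>lines. x \<in> inside L \<and> y \<in> inside L}"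
  have inX: "x \<in> X" if "x \<in> inside L" for x L using that by (simp add: inside_def)
  have "r \<subseteq> X \<times> X" using inX by (auto simp: r_def)
  moreover have "refl_on X r"
    unfolding r_def refl_on_def using uniq by blast
  moreover have "sym r" by (auto simp: r_def sym_def)
  moreover have "trans r"
  proof (rule transI)
    fix a b c assume "(a, b) \<in> r" "(b, c) \<in> r"
    then obtain L L' where L: "L \<in> lines" "a \<in> inside L" "b \<in> inside L"
      "L' \<in> lines" "b \<in> inside L'" "c \<in> inside L'" by (auto simp: r_def)
    then have "L = L'" using uniq[OF inX[OF L(3)]] by blast
    then show "(a, c) \<in> r" using L by (auto simp: r_def)
  qed
  ultimately have "equiv X r" by (simp add: equiv_def)
  moreover have "(g x, g y) \<in> r" if "g \<in> G" "(x, y) \<in> r" for g x y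
    using that(2) line_image[OF that(1)] inside_image[OF that(1)] unfolding r_def by blast
  ultimately have "r = Id_on X \<or> r = X \<times> X" by (rule no_invariant_equiv)
  moreover have "2 \<le> card (inside M)" using M by (simp add: lines_def)
  then obtain u v where uv: "u \<in> inside M" "v \<in> inside M" "u \<noteq> v"
    by (rule two_elements)
  then have "(u, v) \<in> r" using M by (auto simp: r_def)
  ultimately have "r = X \<times> X" using uv(3) by auto
  have all: "z \<in> inside M" if "z \<in> X" for z
  proof -
    have "(u, z) \<in> r" using \<open>r = X \<times> X\<close> that inX[OF uv(1)] by simp
    then obtain L where "L \<in> lines" "u \<in> inside L" "z \<in> inside L" by (auto simp: r_def)
    then show ?thesis using uniq[OF inX[OF uv(1)]] M uv(1) by metis
  qed
  have MX: "M \<subseteq> X" using M by (simp add: lines_def)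
  have self: "z \<notin> nbhd z" for z using adj_irrefl by (simp add: nbhd_def)
  have nb: "nbhd z = M - {z}" if "z \<in> M" for z
    using line_missing_point[OF M all[of z]] that MX self[of z] by blast
  have "X \<subseteq> M"
  proof
    fix z assume z: "z \<in> X"
    obtain m where m: "m \<in> X" "m \<notin> nbhd z" "M = insert m (nbhd z)"
      using line_missing_point[OF M all[OF z]] .
    then show "z \<in> M" using missing_point_unique[OF M all[OF z] all[OF m(1)] _ m(2) self] by auto
  qed
  moreover obtain a b where "a \<in> X" "b \<in> X" "a \<noteq> b" "b \<notin> nbhd a"
    using not_complete by (auto simp: nbhd_def)
  ultimately show False using nb by auto
qed

lemma card_inside_le_two: "card (inside M) \<le> 2" if "M \<subseteq> X" "card M \<le> Suc degree"
proof (rule ccontr)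
  assume "\<not> card (inside M) \<le> 2"
  then have three: "3 \<le> card (inside M)" by simp
  then have "2 \<le> card (inside M)" by simp
  then obtain u v where uv: "u \<in> inside M" "v \<in> inside M" "u \<noteq> v"
    by (rule two_elements)
  \<comment> \<open>Two distinct neighbourhoods fit only into a set of more than \<open>degree\<close> elements.\<close>
  have "card M \<noteq> degree"
  proof
    assume "card M = degree"
    then have eq: "nbhd z = M" if "z \<in> inside M" for z
      using that card_nbhd card_subset_eq[of M "nbhd z"] finite_vertices \<open>M \<subseteq> X\<close>
      by (auto simp: inside_def dest: finite_subset)
    have "nbhd u = nbhd v" using eq[OF uv(1)] eq[OF uv(2)] by simp
    then show False using uv inj_nbhd by (auto simp: inside_def)
  qed
  moreover have "degree \<le> card M"
    using uv(1) card_nbhd card_mono[of M "nbhd u"] finite_vertices \<open>M \<subseteq> X\<close>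
    by (auto simp: inside_def dest: finite_subset)
  ultimately have "M \<in> lines" using that three by (simp add: lines_def)
  then show False using no_lines by simp
qed

end

section \<open>The graph of uncollapsed pairs\<close>

definition uncollapsed :: "'a set \<Rightarrow> ('a \<Rightarrow> 'a) set \<Rightarrow> 'a \<Rightarrow> 'a \<Rightarrow> bool" where
  "uncollapsed X S x y \<longleftrightarrow>
     x \<in> X \<and> y \<in> X \<and> (\<forall>s \<in> generated_semigroup X S. s x \<noteq> s y)"

lemma generated_semigroup_maps:
  assumes "S \<subseteq> X \<rightarrow> X" and "s \<in> generated_semigroup X S"
  shows "s \<in> X \<rightarrow> X"
  using assms(2)
proof induction
  case (product s t)
  then show ?case by (auto simp: compose_def)
qed (use assms(1) in blast)

lemma uncollapsed_image:
  assumes "S \<subseteq> X \<rightarrow> X" and s: "s \<in> generated_semigroup X S" and xy: "uncollapsed X S x y"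
  shows "uncollapsed X S (s x) (s y)"
proof -
  have "t (s x) \<noteq> t (s y)" if "t \<in> generated_semigroup X S" for t
  proof -
    have "compose X t s x \<noteq> compose X t s y"
      using generated_semigroup.product[OF that s] xy by (simp add: uncollapsed_def)
    then show ?thesis using xy by (simp add: uncollapsed_def compose_eq)
  qed
  then show ?thesis
    using funcset_mem[OF generated_semigroup_maps[OF assms(1) s]] xy
    unfolding uncollapsed_def by blast
qed

text \<open>A member of the semigroup with an image of least size is constant if every pair can be
  collapsed, since otherwise collapsing two points of its image would shrink that image.\<close>

lemma constant_if_all_collapse:
  assumes "finite X" and "X \<noteq> {}" and "S \<noteq> {}" and "S \<subseteq> X \<rightarrow> X"
    and "\<And>x y. \<not> uncollapsed X S x y"
  shows "\<exists>h \<in> generated_semigroup X S. \<exists>c\<in>X. \<forall>x\<in>X. h x = c"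
proof -
  obtain s0 where "s0 \<in> generated_semigroup X S"
    using assms(3) generated_semigroup.generator by blast
  then obtain s where s: "s \<in> generated_semigroup X S"
    and least: "\<And>t. t \<in> generated_semigroup X S \<Longrightarrow> card (s ` X) \<le> card (t ` X)"
    using ex_has_least_nat[of "\<lambda>s. s \<in> generated_semigroup X S" s0 "\<lambda>s. card (s ` X)"] by blast
  have sX: "s x \<in> X" if "x \<in> X" for x
    using generated_semigroup_maps[OF assms(4) s] that by blast
  have "s x = s y" if xy: "x \<in> X" "y \<in> X" for x y
  proof (rule ccontr)
    assume ne: "s x \<noteq> s y"
    obtain t where t: "t \<in> generated_semigroup X S" "t (s x) = t (s y)"
      using assms(5)[of "s x" "s y"] sX xy by (auto simp: uncollapsed_def)
    have "compose X t s ` X = t ` (s ` X)" by (auto simp: compose_def)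
    moreover have "\<not> inj_on t (s ` X)" using ne t(2) xy by (auto simp: inj_on_def)
    ultimately have "card (compose X t s ` X) < card (s ` X)"
      using assms(1) by (metis card_image_le eq_card_imp_inj_on finite_imageI le_neq_implies_less)
    then show False using least[OF generated_semigroup.product[OF t(1) s]] by simp
  qed
  then show ?thesis using s sX assms(2) by (metis ex_in_conv)
qed

section \<open>Kernel type (p,2,1,...,1)\<close>

lemma mset_set_image_split:
  assumes "finite K" and "image_mset h (mset_set K) = add_mset n N"
  obtains A where "A \<in> K" "h A = n" "image_mset h (mset_set (K - {A})) = N"
proof -
  have "n \<in># image_mset h (mset_set K)" using assms(2) by simp
  then obtain A where A: "A \<in> K" "h A = n" using assms(1) by auto
  have "mset_set K = add_mset A (mset_set (K - {A}))"
    using assms(1) A(1) by (rule mset_set.remove)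
  then have "add_mset (h A) (image_mset h (mset_set (K - {A}))) = add_mset n N"
    using assms(2) by (metis image_mset_add_mset)
  then show ?thesis using A by (intro that[of A]) simp_all
qed

lemma kernel_type_classes:
  assumes "finite X" and "kernel_type X f = {#p, 2#} + replicate_mset k 1"
  obtains a b where "card {x \<in> X. f x = a} = p" "a \<noteq> b" "card {x \<in> X. f x = b} = 2"
    "\<forall>x\<in>X. \<forall>y\<in>X. f x = f y \<longrightarrow> x \<noteq> y \<longrightarrow> f x = a \<or> f x = b"
proof -
  let ?C = "\<lambda>y. {x \<in> X. f x = y}"
  define K where "K = kernel_classes X f"
  have fin: "finite K" using assms(1) by (simp add: K_def kernel_classes_def)
  have "image_mset card (mset_set K) = add_mset p (add_mset 2 (replicate_mset k 1))"
    using assms(2) by (simp add: K_def kernel_type_def)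
  then obtain A where A: "A \<in> K" "card A = p"
    "image_mset card (mset_set (K - {A})) = add_mset 2 (replicate_mset k 1)"
    using mset_set_image_split[OF fin] by metis
  then obtain B where B: "B \<in> K - {A}" "card B = 2"
    "image_mset card (mset_set (K - {A} - {B})) = replicate_mset k 1"
    using mset_set_image_split[of "K - {A}"] fin by (metis finite_Diff)
  have single: "card C = 1" if "C \<in> K - {A} - {B}" for C
  proof -
    have "card C \<in># replicate_mset k 1"
      using that fin B(3) by (metis finite_Diff finite_set_mset_mset_set image_eqI set_image_mset)
    then show ?thesis by (simp split: if_splits)
  qed
  obtain a where a: "A = ?C a" using A(1) by (auto simp: K_def kernel_classes_def)
  obtain b where b: "B = ?C b" using B(1) by (auto simp: K_def kernel_classes_def)
  have "f x = a \<or> f x = b" if xy: "x \<in> X" "y \<in> X" "f x = f y" "x \<noteq> y" for x y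
  proof (rule ccontr)
    assume no: "\<not> (f x = a \<or> f x = b)"
    then have "?C (f x) \<noteq> A" "?C (f x) \<noteq> B" using a b xy(1) by blast+
    moreover have "?C (f x) \<in> K" using xy(1) by (auto simp: K_def kernel_classes_def)
    ultimately have "card (?C (f x)) = 1" using single by blast
    then obtain c where c: "?C (f x) = {c}" using card_1_singletonE by blast
    have "x \<in> ?C (f x)" "y \<in> ?C (f x)" using xy by auto
    then show False using xy(4) unfolding c by simp
  qed
  then have "\<forall>x\<in>X. \<forall>y\<in>X. f x = f y \<longrightarrow> x \<noteq> y \<longrightarrow> f x = a \<or> f x = b" by blast
  moreover have "a \<noteq> b" using a b B(1) by blast
  ultimately show ?thesis using that[of a b] a b A(2) B(2) by simp
qed

theorem theorem4p8:
  fixes X :: "'a set" and G :: "('a \<Rightarrow> 'a) set" and f :: "'a \<Rightarrow> 'a" and p k :: nat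
  assumes "finite X" and "card X \<ge> 6"
    and "p \<ge> 3"
    and "primitive_perm_group X G"
    and "f \<in> X \<rightarrow>\<^sub>E X"
    and "kernel_type X f = {#p, 2#} + replicate_mset k 1"
  shows "synchronizes X G f"
proof (rule ccontr)
  assume not_sync: "\<not> synchronizes X G f"
  let ?adj = "uncollapsed X (insert f G)"
  have maps: "insert f G \<subseteq> X \<rightarrow> X"
    using perm_group_maps(1)[OF assms(4)] assms(5) by auto
  have f_gen: "f \<in> generated_semigroup X (insert f G)"
    by (simp add: generated_semigroup.generator)
  have adj_f: "f x \<noteq> f y" if "?adj x y" for x y
    using that f_gen by (simp add: uncollapsed_def)
  obtain a b where A: "card {x \<in> X. f x = a} = p"
    and "a \<noteq> b" and B: "card {x \<in> X. f x = b} = 2"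
    and collapse: "\<forall>x\<in>X. \<forall>y\<in>X. f x = f y \<longrightarrow> x \<noteq> y \<longrightarrow> f x = a \<or> f x = b"
    using kernel_type_classes[OF assms(1,6)] by blast
  obtain b1 b2 where b12: "{x \<in> X. f x = b} = {b1, b2}" "b1 \<noteq> b2"
    using B by (auto simp: card_2_iff)

  interpret primitive_graph X G ?adj
  proof
    show "?adj (g x) (g y)" if "g \<in> G" "?adj x y" for g x y
      using uncollapsed_image[OF maps _ that(2)] that(1)
      by (simp add: generated_semigroup.generator)
    have "X \<noteq> {}" using assms(2) by auto
    then show "\<exists>x y. ?adj x y"
      using constant_if_all_collapse[OF assms(1) _ _ maps] not_sync
      unfolding synchronizes_def by blast
    have "b1 \<in> {x \<in> X. f x = b}" "b2 \<in> {x \<in> X. f x = b}" unfolding b12(1) by simp_all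
    then have "b1 \<in> X" "b2 \<in> X" "f b1 = f b2" by auto
    then show "\<exists>x\<in>X. \<exists>y\<in>X. x \<noteq> y \<and> \<not> ?adj x y" using b12(2) adj_f by blast
  qed (use assms(1,4) adj_f in \<open>auto simp: uncollapsed_def\<close>)

  define M where "M = (\<Union>x \<in> {x \<in> X. f x = a}. nbhd x)"
  have "M \<subseteq> X" using nbhd_subset by (auto simp: M_def)
  then have "finite M" using assms(1) finite_subset by blast
  have off_A: "f y \<noteq> a" if "y \<in> M" for y
    using that adj_f by (force simp: M_def nbhd_def)
  \<comment> \<open>The only collapse that \<open>f\<close> can cause on \<open>M\<close> is that of the two-element class.\<close>
  have "inj_on f (M - {b2})"
  proof (rule inj_onI, rule ccontr)
    fix x y assume xy: "x \<in> M - {b2}" "y \<in> M - {b2}" "f x = f y" "x \<noteq> y"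
    then have "f x = b" using collapse \<open>M \<subseteq> X\<close> off_A[of x] by auto
    then have "x \<in> {b1, b2}" "y \<in> {b1, b2}" using xy \<open>M \<subseteq> X\<close> b12(1) by auto
    then show False using xy by auto
  qed
  then have "card (M - {b2}) = card (f ` (M - {b2}))" by (simp add: card_image)
  also have "\<dots> \<le> card (nbhd a)"
  proof (rule card_mono[OF finite_nbhd])
    show "f ` (M - {b2}) \<subseteq> nbhd a"
      using uncollapsed_image[OF maps f_gen] by (force simp: M_def nbhd_def)
  qed
  also have "\<dots> = degree"
  proof (rule card_nbhd)
    have "{x \<in> X. f x = a} \<noteq> {}" using A assms(3) by force
    then show "a \<in> X" using maps by auto
  qed
  finally have "card M \<le> Suc degree" using card_Diff1_le[of M b2] \<open>finite M\<close>
    by (cases "b2 \<in> M") (auto simp: card_Diff_singleton)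
  then have "card (inside M) \<le> 2" using card_inside_le_two \<open>M \<subseteq> X\<close> by blast
  \<comment> \<open>All points of the class of size \<open>p\<close> have their neighbourhoods in \<open>M\<close>.\<close>
  moreover have "p \<le> card (inside M)"
    unfolding A[symmetric] by (rule card_mono[OF finite_inside]) (auto simp: inside_def M_def)
  ultimately show False using assms(3) by simp
qed

end
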